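(* Let $(D,B_0)$ be a dimaze (possibly infinite) that does not contain any alternating comb. Then a set $B\subseteq V(D)$ is a maximal element (with respect to inclusion) of the family of all linkable subsets of $V(D)$ if and only if $B$ is linkable onto $B_0$.
   Context: Dimazes: a dimaze is a pair $(D,B_0)$ where $D$ is a digraph (of arbitrary cardinality) and $B_0$ is a subset of the set of vertices of $D$ of out-degree $0$; the elements of $B_0$ are called exits. A linkage is a set $\mathcal P$ of pairwise (vertex-)disjoint finite directed paths (possibly trivial, i.e. consisting of a single vertex) in $D$, each of whose terminal vertices lies in $B_0$. $\mathrm{Ini}(\mathcal P)$ and $\mathrm{Ter}(\mathcal P)$ are the sets of initial, respectively terminal, vertices of the paths in $\mathcal P$. A set $I\subseteq V(D)$ is linkable (or independent) if there is a linkage $\mathcal P$ with $\mathrm{Ini}(\mathcal P)=I$; it is linkable onto $B_0$ if $\mathcal P$ can be chosen with in addition $\mathrm{Ter}(\mathcal P)=B_0$. Alternating combs: an alternating ray is a digraph whose underlying graph is a ray (a one-way infinite path) and which has infinitely many vertices of in-degree $2$. An alternating comb is a dimaze constructed from an alternating ray by linking all its vertices of in-degree $2$ together with its first vertex onto a set of exits by (possibly trivial) pairwise disjoint directed paths which meet the ray exactly at their initial vertices. A dimaze $(D,B_0)$ contains an alternating comb if $D$ contains the digraph of some alternating comb as a subdigraph and $B_0$ contains the exits of that alternating comb. *)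

theory Defs
  imports "Graph_Theory.Arc_Walk" "Graph_Theory.Digraph_Component"
begin

text \<open>
  Digraphs are those of \<^locale>\<open>wf_digraph\<close>: arbitrary cardinality, loops and parallel arcs
  allowed.  Out-degree zero is expressed by an empty set of outgoing arcs, because
  \<^const>\<open>out_degree\<close> is a cardinality and hence also zero at vertices of infinite out-degree.
\<close>

definition dimaze :: "('a, 'b) pre_digraph \<Rightarrow> 'a set \<Rightarrow> bool" where
  "dimaze D B0 \<longleftrightarrow> wf_digraph D \<and> B0 \<subseteq> {v \<in> verts D. out_arcs D v = {}}"

text \<open>
  A path is represented by a pair \<open>(u, p)\<close> of its initial vertex and its list of arcs, so that
  \<open>(u, [])\<close> is the trivial path at \<open>u\<close>.
\<close>

abbreviation path_verts :: "('a, 'b) pre_digraph \<Rightarrow> 'a \<times> 'b awalk \<Rightarrow> 'a set" where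
  "path_verts D P \<equiv> set (pre_digraph.awalk_verts D (fst P) (snd P))"

abbreviation path_end :: "('a, 'b) pre_digraph \<Rightarrow> 'a \<times> 'b awalk \<Rightarrow> 'a" where
  "path_end D P \<equiv> pre_digraph.awlast D (fst P) (snd P)"

definition linkage :: "('a, 'b) pre_digraph \<Rightarrow> 'a set \<Rightarrow> ('a \<times> 'b awalk) set \<Rightarrow> bool" where
  "linkage D B0 \<P> \<longleftrightarrow>
     (\<forall>P\<in>\<P>. pre_digraph.apath D (fst P) (snd P) (path_end D P) \<and> path_end D P \<in> B0) \<and>
     (\<forall>P\<in>\<P>. \<forall>Q\<in>\<P>. P \<noteq> Q \<longrightarrow> path_verts D P \<inter> path_verts D Q = {})"

definition Ini :: "('a \<times> 'b awalk) set \<Rightarrow> 'a set" where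
  "Ini \<P> = fst ` \<P>"

definition Ter :: "('a, 'b) pre_digraph \<Rightarrow> ('a \<times> 'b awalk) set \<Rightarrow> 'a set" where
  "Ter D \<P> = path_end D ` \<P>"

definition linkable :: "('a, 'b) pre_digraph \<Rightarrow> 'a set \<Rightarrow> 'a set \<Rightarrow> bool" where
  "linkable D B0 I \<longleftrightarrow> (\<exists>\<P>. linkage D B0 \<P> \<and> Ini \<P> = I)"

definition linkable_onto_exits :: "('a, 'b) pre_digraph \<Rightarrow> 'a set \<Rightarrow> 'a set \<Rightarrow> bool" where
  "linkable_onto_exits D B0 I \<longleftrightarrow> (\<exists>\<P>. linkage D B0 \<P> \<and> Ini \<P> = I \<and> Ter D \<P> = B0)"

text \<open>
  The underlying graph of \<open>R\<close> is the ray \<open>r 0, r 1, r 2, \<dots>\<close>: any two consecutive vertices are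
  joined by exactly one arc, in either direction, and there are no other arcs.
\<close>

definition underlying_ray :: "('a, 'b) pre_digraph \<Rightarrow> (nat \<Rightarrow> 'a) \<Rightarrow> bool" where
  "underlying_ray R r \<longleftrightarrow>
     wf_digraph R \<and> inj r \<and> verts R = range r \<and>
     (\<exists>e. bij_betw e UNIV (arcs R) \<and>
          (\<forall>i. {tail R (e i), head R (e i)} = {r i, r (Suc i)}))"

definition alternating_ray :: "('a, 'b) pre_digraph \<Rightarrow> (nat \<Rightarrow> 'a) \<Rightarrow> bool" where
  "alternating_ray R r \<longleftrightarrow>
     underlying_ray R r \<and> infinite {v \<in> verts R. in_degree R v = 2}"

definition alternating_comb :: "('a, 'b) pre_digraph \<Rightarrow> 'a set \<Rightarrow> bool" where
  "alternating_comb C X \<longleftrightarrow> dimaze C X \<and>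
     (\<exists>R r \<P>. alternating_ray R r \<and> subgraph R C \<and> linkage C X \<P> \<and>
        Ini \<P> = insert (r 0) {v \<in> verts R. in_degree R v = 2} \<and> Ter C \<P> = X \<and>
        (\<forall>P\<in>\<P>. path_verts C P \<inter> verts R = {fst P}) \<and>
        verts C = verts R \<union> (\<Union>P\<in>\<P>. path_verts C P) \<and>
        arcs C = arcs R \<union> (\<Union>P\<in>\<P>. set (snd P)))"

definition contains_alternating_comb :: "('a, 'b) pre_digraph \<Rightarrow> 'a set \<Rightarrow> bool" where
  "contains_alternating_comb D B0 \<longleftrightarrow>
     (\<exists>C X. alternating_comb C X \<and> subgraph C D \<and> X \<subseteq> B0)"

end

theory Submission
  imports Defs
begin

text \<open>
  If \<open>B\<close> is linked by \<open>P\<close> and maximal, the trivial paths at the exits missed by \<open>P\<close> can be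
  added to \<open>P\<close>, so by maximality there are none.

  Conversely, let \<open>P\<close> link \<open>B\<close> onto all exits and let \<open>Q\<close> link a proper superset of \<open>B\<close>.  Deferred
  acceptance, as in Pym's linkage theorem, yields an initial segment of every path of \<open>Q\<close> such that
  these segments end exactly in the vertices where some path of \<open>P\<close> meets a segment for the last
  time; call these vertices stops.  Start at the stop of a path of \<open>Q\<close> whose initial vertex is not
  in \<open>B\<close>, go backwards along \<open>P\<close> to the next vertex on a segment, forwards along that segment to
  its stop, backwards along \<open>P\<close> again, and so on.  Every stop visited is reached by the deferred
  acceptance later than the preceding one, so this never repeats and gives an alternating ray.  Its
  first vertex and its vertices of in-degree 2 are stops, and the final segments of the paths of \<open>P\<close>
  beyond these stops complete it to an alternating comb.
\<close>

section \<open>Positions on the paths of a linkage\<close>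

locale path_system = wf_digraph G for G :: "('a, 'b) pre_digraph" (structure) +
  fixes X :: "'a set" and L :: "('a \<times> 'b awalk) set"
  assumes linkage: "linkage G X L"
begin

definition V :: "'a set" where
  "V = (\<Union>S\<in>L. path_verts G S)"

definition E :: "'b set" where
  "E = (\<Union>S\<in>L. set (snd S))"

definition own :: "'a \<Rightarrow> 'a \<times> 'b awalk" where
  "own v = (THE S. S \<in> L \<and> v \<in> path_verts G S)"

text \<open>Together with \<open>own\<close> this gives coordinates on \<open>V\<close>: vertices
  are compared by path and index rather than through lists.\<close>

definition pos :: "'a \<Rightarrow> nat" where
  "pos v = (THE k. k \<le> length (snd (own v)) \<and> awalk_verts (fst (own v)) (snd (own v)) ! k = v)"

lemma path:
  assumes "S \<in> L"
  shows "apath (fst S) (snd S) (path_end G S)" "path_end G S \<in> X"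
  using linkage assms by (auto simp: linkage_def)

lemma own_eqI:
  assumes "S \<in> L" "v \<in> path_verts G S"
  shows "own v = S"
  unfolding own_def using linkage assms
  by (intro the_equality) (auto simp: linkage_def disjoint_iff)

lemma own_nth:
  assumes "S \<in> L" "k \<le> length (snd S)"
  shows "own (awalk_verts (fst S) (snd S) ! k) = S"
  using assms by (intro own_eqI) (auto simp: length_awalk_verts)

lemma pos_nth:
  assumes "S \<in> L" "k \<le> length (snd S)"
  shows "pos (awalk_verts (fst S) (snd S) ! k) = k"
proof -
  have "distinct (awalk_verts (fst S) (snd S))"
    using path(1)[OF assms(1)] by (simp add: apath_def)
  then show ?thesis
    unfolding pos_def own_nth[OF assms] using assms(2)
    by (intro the_equality) (auto simp: nth_eq_iff_index_eq length_awalk_verts)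
qed

lemma V_cases:
  assumes "v \<in> V"
  obtains "own v \<in> L" "pos v \<le> length (snd (own v))"
    "awalk_verts (fst (own v)) (snd (own v)) ! pos v = v"
proof -
  from assms obtain S k where "S \<in> L" "k \<le> length (snd S)"
    "v = awalk_verts (fst S) (snd S) ! k"
    by (auto simp: V_def in_set_conv_nth length_awalk_verts less_Suc_eq_le)
  then show thesis using that own_nth pos_nth by simp
qed

lemma own_pos_inj:
  assumes "v \<in> V" "w \<in> V" "own v = own w" "pos v = pos w"
  shows "v = w"
  using assms by (metis V_cases)

lemma nth_arc:
  assumes "S \<in> L" "k < length (snd S)"
  shows "tail G (snd S ! k) = awalk_verts (fst S) (snd S) ! k"
    and "head G (snd S ! k) = awalk_verts (fst S) (snd S) ! Suc k"
proof -
  have "cas (fst S) (snd S) (path_end G S)" "snd S \<noteq> []"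
    using path(1)[OF assms(1)] assms(2) by (auto simp: apath_def awalk_def)
  then show "tail G (snd S ! k) = awalk_verts (fst S) (snd S) ! k"
    "head G (snd S ! k) = awalk_verts (fst S) (snd S) ! Suc k"
    using assms(2) by (simp add: awalk_verts_conv nth_append, simp add: awalk_verts_conv')
qed

lemma nth_in_V: "S \<in> L \<Longrightarrow> k \<le> length (snd S) \<Longrightarrow> awalk_verts (fst S) (snd S) ! k \<in> V"
  unfolding V_def by (force simp: length_awalk_verts)

lemma nth_in_E: "S \<in> L \<Longrightarrow> k < length (snd S) \<Longrightarrow> snd S ! k \<in> E"
  unfolding E_def by force

text \<open>Traversing an arc keeps \<open>own\<close> and raises \<open>pos\<close> by one. The
  last clause recovers an arc from its tail, so arcs of a linkage are determined by either
  end.\<close>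

lemma E_cases:
  assumes "e \<in> E"
  obtains "e \<in> arcs G" "tail G e \<in> V" "head G e \<in> V" "own (head G e) = own (tail G e)"
    "pos (head G e) = Suc (pos (tail G e))" "pos (tail G e) < length (snd (own (tail G e)))"
    "e = snd (own (tail G e)) ! pos (tail G e)"
proof -
  from assms obtain S k where S: "S \<in> L" "k < length (snd S)" "e = snd S ! k"
    by (auto simp: E_def in_set_conv_nth)
  moreover from S have "e \<in> arcs G"
    using path(1)[OF S(1)] by (auto simp: apath_def awalk_def)
  ultimately show thesis
    using that nth_arc[OF S(1,2)] own_nth[of S k] own_nth[of S "Suc k"]
      pos_nth[of S k] pos_nth[of S "Suc k"] nth_in_V[of S k] nth_in_V[of S "Suc k"]
    by simp
qed

lemma E_tail_inj: "e \<in> E \<Longrightarrow> e' \<in> E \<Longrightarrow> tail G e = tail G e' \<Longrightarrow> e = e'"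
  by (metis E_cases)

lemma E_head_inj: "e \<in> E \<Longrightarrow> e' \<in> E \<Longrightarrow> head G e = head G e' \<Longrightarrow> e = e'"
  by (metis E_cases nat.inject)

lemma Ini_V: "v \<in> Ini L \<Longrightarrow> v \<in> V \<and> pos v = 0"
proof -
  assume "v \<in> Ini L"
  then obtain S where S: "S \<in> L" "v = fst S" by (auto simp: Ini_def)
  moreover from path(1)[OF S(1)] have "awalk_verts (fst S) (snd S) ! 0 = fst S"
    by (metis apath_def awalk_conv awalk_verts_non_Nil hd_conv_nth)
  ultimately show ?thesis using nth_in_V[of S 0] pos_nth[of S 0] by simp
qed

lemma head_notin_Ini: "e \<in> E \<Longrightarrow> head G e \<notin> Ini L"
  by (metis E_cases Ini_V nat.distinct(1))

lemma in_arc: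
  assumes "v \<in> V" "v \<notin> Ini L"
  obtains e where "e \<in> E" "head G e = v"
proof -
  obtain S k where S: "S \<in> L" "k \<le> length (snd S)" "v = awalk_verts (fst S) (snd S) ! k"
    using assms(1) by (metis V_cases)
  have "awalk_verts (fst S) (snd S) ! 0 = fst S"
    using path(1)[OF S(1)] by (metis apath_def awalk_conv awalk_verts_non_Nil hd_conv_nth)
  with S assms(2) have "k \<noteq> 0" by (auto simp: Ini_def)
  then obtain j where "k = Suc j" by (cases k) auto
  with S that[of "snd S ! j"] nth_arc[of S j] nth_in_E[of S j] show thesis by simp
qed

lemma end_nth:
  "S \<in> L \<Longrightarrow> path_end G S = awalk_verts (fst S) (snd S) ! length (snd S)"
  by (simp add: last_conv_nth length_awalk_verts)

lemma Ter_V: "v \<in> Ter G L \<Longrightarrow> v \<in> V \<and> pos v = length (snd (own v))"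
  using nth_in_V pos_nth own_nth by (auto simp: Ter_def end_nth)

lemma out_arc:
  assumes "v \<in> V" "v \<notin> Ter G L"
  obtains e where "e \<in> E" "tail G e = v"
proof -
  obtain S k where S: "S \<in> L" "k \<le> length (snd S)" "v = awalk_verts (fst S) (snd S) ! k"
    using assms(1) by (metis V_cases)
  with assms(2) have "k < length (snd S)"
    using end_nth[of S] by (cases "k = length (snd S)") (auto simp: Ter_def image_iff)
  with S that[of "snd S ! k"] nth_arc[of S k] nth_in_E[of S k] show thesis by simp
qed

lemma Ter_subset: "Ter G L \<subseteq> X"
  using path(2) by (auto simp: Ter_def)

section \<open>Final segments of the paths\<close>

definition suffix_path :: "'a \<Rightarrow> 'a \<times> 'b awalk" where
  "suffix_path v = (v, drop (pos v) (snd (own v)))"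

text \<open>The description by coordinates turns disjointness of final segments, and their
  intersections with the ray, into comparisons of positions.\<close>

lemma suffix_path:
  assumes "v \<in> V"
  shows "apath v (snd (suffix_path v)) (path_end G (suffix_path v))"
    and "path_verts G (suffix_path v) = {w \<in> V. own w = own v \<and> pos v \<le> pos w}"
    and "path_end G (suffix_path v) \<in> Ter G L"
    and "set (snd (suffix_path v)) \<subseteq> E"
proof -
  obtain u p k where S: "(u, p) \<in> L" "k \<le> length p" "v = awalk_verts u p ! k" "own v = (u, p)"
    "pos v = k"
    using V_cases[OF assms] by (metis prod.collapse)
  have ap: "apath u p (awlast u p)" using path(1)[OF S(1)] by simp
  then have cas: "cas u p (awlast u p)" and dist: "distinct (awalk_verts u p)"
    by (auto simp: apath_def awalk_def)
  have verts: "awalk_verts v (drop k p) = drop k (awalk_verts u p)"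
  proof (cases "k < length p")
    case True
    then show ?thesis using awalk_verts_drop_conv[OF cas] by simp
  next
    case False
    \<comment> \<open>Here \<open>v\<close> is the last vertex: no arcs remain, and the walk from
      \<open>v\<close> has the single vertex \<open>v\<close>.\<close>
    with S have "k = length p" by simp
    moreover have "drop (length p) (awalk_verts u p) = [awalk_verts u p ! length p]"
      using Cons_nth_drop_Suc[of "length p" "awalk_verts u p"] by (simp add: length_awalk_verts)
    ultimately show ?thesis using S by simp
  qed
  have lst: "path_end G (suffix_path v) = awlast u p"
    unfolding suffix_path_def using S verts by (simp add: last_drop length_awalk_verts)
  have "awalk_verts u (take k p) = take (Suc k) (awalk_verts u p)"
    using awalk_verts_take_conv[OF cas] .
  then have "awlast u (take k p) = v"
    using S by (simp add: last_conv_nth length_awalk_verts min_def)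
  moreover have "awalk u (take k p @ drop k p) (awlast u p)"
    using ap by (simp add: apath_def del: awalk_append_iff)
  ultimately have "awalk v (drop k p) (awlast u p)"
    unfolding awalk_append_iff by simp
  then show "apath v (snd (suffix_path v)) (path_end G (suffix_path v))"
    unfolding apath_def lst using S verts dist by (simp add: suffix_path_def)
  show "path_end G (suffix_path v) \<in> Ter G L"
    unfolding lst Ter_def using S(1) by force
  show "set (snd (suffix_path v)) \<subseteq> E"
    unfolding suffix_path_def E_def using S by (auto dest!: in_set_dropD)
  show "path_verts G (suffix_path v) = {w \<in> V. own w = own v \<and> pos v \<le> pos w}"
  proof (intro set_eqI iffI)
    fix w assume "w \<in> path_verts G (suffix_path v)"
    then have "w \<in> set (drop k (awalk_verts u p))"
      using verts S by (simp add: suffix_path_def)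
    then obtain i where "i < Suc (length p) - k" "w = awalk_verts u p ! (k + i)"
      by (auto simp: in_set_conv_nth length_awalk_verts)
    then show "w \<in> {w \<in> V. own w = own v \<and> pos v \<le> pos w}"
      using S nth_in_V[of "(u, p)" "k + i"] own_nth[of "(u, p)" "k + i"] pos_nth[of "(u, p)" "k + i"]
      by simp
  next
    fix w assume w: "w \<in> {w \<in> V. own w = own v \<and> pos v \<le> pos w}"
    then have own: "own w = (u, p)" "k \<le> pos w" "w \<in> V" using S by auto
    have *: "awalk_verts u p ! pos w = w" "pos w \<le> length p"
      using V_cases[OF own(3)] own(1) by auto
    then have "w = drop k (awalk_verts u p) ! (pos w - k)"
      using S * own(2) by (simp add: length_awalk_verts)
    also have "\<dots> \<in> set (drop k (awalk_verts u p))"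
      using * own(2) by (intro nth_mem) (simp add: length_awalk_verts)
    finally show "w \<in> path_verts G (suffix_path v)"
      using verts S by (simp add: suffix_path_def)
  qed
qed

end

section \<open>Deferred acceptance between two linkages\<close>

locale excess_linkage = P: path_system G B0 P + Q: path_system G B0 Q
  for G :: "('a, 'b) pre_digraph" (structure) and B0 P Q +
  assumes Ter_P: "Ter G P = B0" and Ini_subset: "Ini P \<subseteq> Ini Q"
begin

definition later :: "'a \<Rightarrow> 'a \<Rightarrow> bool" where
  "later v w \<longleftrightarrow> v \<in> P.V \<and> w \<in> P.V \<and> P.own w = P.own v \<and> P.pos v < P.pos w"

text \<open>
  All paths of \<open>Q\<close> are walked along simultaneously: a walker leaves \<open>v\<close> if no path of \<open>P\<close>
  contains \<open>v\<close>, or if some walker has come to a later vertex of the path of \<open>P\<close> through \<open>v\<close>.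
\<close>

primrec reached_by :: "nat \<Rightarrow> 'a set" where
  "reached_by 0 = Ini Q"
| "reached_by (Suc n) = reached_by n \<union>
     {head G e | e. e \<in> Q.E \<and> tail G e \<in> reached_by n \<and>
        (tail G e \<in> P.V \<longrightarrow> (\<exists>w \<in> reached_by n. later (tail G e) w))}"

definition reached :: "'a set" where
  "reached = (\<Union>n. reached_by n)"

definition time :: "'a \<Rightarrow> nat" where
  "time v = (LEAST n. v \<in> reached_by n)"

definition stop :: "'a \<Rightarrow> bool" where
  "stop v \<longleftrightarrow> v \<in> reached \<and> (\<forall>e \<in> Q.E. tail G e = v \<longrightarrow> head G e \<notin> reached)"

section \<open>The reached vertices and the stops\<close>

lemma reached_by_mono: "m \<le> n \<Longrightarrow> reached_by m \<subseteq> reached_by n"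
  by (rule lift_Suc_mono_le) auto

lemma time_le: "v \<in> reached_by n \<Longrightarrow> time v \<le> n"
  unfolding time_def by (rule Least_le)

lemma Ini_reached: "Ini Q \<subseteq> reached"
  unfolding reached_def by (metis UN_upper UNIV_I reached_by.simps(1))

lemma reached_V: "reached \<subseteq> Q.V"
proof -
  have "reached_by n \<subseteq> Q.V" for n
    by (induction n) (auto dest: Q.Ini_V elim: Q.E_cases)
  then show ?thesis by (auto simp: reached_def)
qed

text \<open>No arc of \<open>Q\<close> enters \<open>Ini Q\<close>, so \<open>head G e\<close> was
  new in some round \<open>Suc n\<close>, and everything that permitted this was present in round
  \<open>n\<close>. The strict inequalities of times drive \<open>key_step\<close>.\<close>

lemma reached_head:
  assumes "e \<in> Q.E" "head G e \<in> reached"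
  shows "tail G e \<in> reached" "time (tail G e) < time (head G e)"
    and "tail G e \<in> P.V \<Longrightarrow> \<exists>w \<in> reached. later (tail G e) w \<and> time w < time (head G e)"
proof -
  have mem: "head G e \<in> reached_by (time (head G e))"
    using assms(2) unfolding reached_def time_def by (auto intro: LeastI)
  moreover have "head G e \<notin> Ini Q"
    using Q.head_notin_Ini[OF assms(1)] .
  ultimately obtain n where n: "time (head G e) = Suc n"
    by (metis not0_implies_Suc reached_by.simps(1))
  then have "head G e \<notin> reached_by n"
    using time_le[of "head G e" n] by auto
  with mem n obtain e' where e': "e' \<in> Q.E" "head G e' = head G e" "tail G e' \<in> reached_by n"
    "tail G e' \<in> P.V \<longrightarrow> (\<exists>w \<in> reached_by n. later (tail G e') w)"
    unfolding n reached_by.simps Un_iff mem_Collect_eq by metis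
  \<comment> \<open>Arcs of \<open>Q\<close> with a common head coincide, so the advance was made
    along \<open>e\<close> itself.\<close>
  have eq: "e' = e" using Q.E_head_inj[OF e'(1) assms(1) e'(2)] .
  show "tail G e \<in> reached" using e'(3) eq by (auto simp: reached_def)
  show "time (tail G e) < time (head G e)"
    using e'(3) eq n by (auto simp: less_Suc_eq_le intro: time_le)
  assume "tail G e \<in> P.V"
  with e'(4) eq obtain w where "w \<in> reached_by n" "later (tail G e) w" by auto
  then show "\<exists>w \<in> reached. later (tail G e) w \<and> time w < time (head G e)"
    using n time_le[of w n] by (intro bexI[of _ w]) (auto simp: reached_def)
qed

lemma reached_advance:
  assumes "e \<in> Q.E" "tail G e \<in> reached" "tail G e \<in> P.V \<Longrightarrow> \<exists>w \<in> reached. later (tail G e) w"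
  shows "head G e \<in> reached"
proof (cases "tail G e \<in> P.V")
  case True
  with assms obtain w m n where w: "w \<in> reached_by m" "later (tail G e) w" "tail G e \<in> reached_by n"
    by (auto simp: reached_def)
  \<comment> \<open>The two vertices may be reached in different rounds; both are present in round
    \<open>max m n\<close>.\<close>
  then have "w \<in> reached_by (max m n)" "tail G e \<in> reached_by (max m n)"
    using reached_by_mono by (meson max.cobounded1 max.cobounded2 subsetD)+
  with w(2) assms(1) have "head G e \<in> reached_by (Suc (max m n))" by auto
  then show ?thesis unfolding reached_def by blast
next
  case False
  from assms obtain n where "tail G e \<in> reached_by n" by (auto simp: reached_def)
  with False assms(1) have "head G e \<in> reached_by (Suc n)" by auto
  then show ?thesis unfolding reached_def by blast
qed

text \<open>A walker halts for one of two reasons. Either its path of \<open>Q\<close> ends, at an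
  exit, which by \<open>Ter_P\<close> is the end of a path of \<open>P\<close>; or its next arc is
  refused, which by \<open>reached_advance\<close> happens only on a path of \<open>P\<close> with
  no later reached vertex.\<close>

lemma stop_last:
  assumes "stop v"
  shows "v \<in> P.V" "w \<in> reached \<Longrightarrow> \<not> later v w"
proof -
  have "v \<in> P.V \<and> (\<forall>w \<in> reached. \<not> later v w)"
  proof (cases "v \<in> Ter G Q")
    case True
    then have "v \<in> Ter G P" using Q.Ter_subset Ter_P by auto
    then show ?thesis using P.Ter_V by (metis P.V_cases later_def not_le)
  next
    case False
    with assms obtain e where "e \<in> Q.E" "tail G e = v"
      using Q.out_arc reached_V by (metis stop_def subsetD)
    with assms show ?thesis using reached_advance[of e] by (auto simp: stop_def)
  qed
  then show "v \<in> P.V" "w \<in> reached \<Longrightarrow> \<not> later v w" by auto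
qed

text \<open>Positions on one path of \<open>P\<close> are comparable, and neither stop can be later
  than the other.\<close>

lemma stop_unique:
  assumes "stop v" "stop w" "P.own v = P.own w"
  shows "v = w"
proof -
  have "\<not> later v w" "\<not> later w v"
    using stop_last(2) assms by (auto simp: stop_def)
  with assms show ?thesis
    using stop_last(1) by (intro P.own_pos_inj) (auto simp: later_def)
qed

text \<open>
  The ray is determined by its current vertex: at a vertex satisfying \<open>up\<close> it goes forwards along
  \<open>Q\<close>, at one satisfying \<open>down\<close> it goes backwards along \<open>P\<close>.  In the latter case \<open>m\<close> is the stop
  at which the ray turned, and nothing strictly between \<open>m\<close> and the current vertex is reached.
\<close>

definition up :: "'a \<Rightarrow> bool" where
  "up v \<longleftrightarrow> v \<in> reached \<and> \<not> stop v"

definition down :: "'a \<Rightarrow> bool" where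
  "down v \<longleftrightarrow> v \<in> P.V \<and> v \<notin> Ini P \<and>
     (\<exists>m. stop m \<and> P.own m = P.own v \<and> P.pos v \<le> P.pos m \<and>
        (\<forall>w \<in> reached \<inter> P.V. P.own w = P.own v \<and> P.pos v \<le> P.pos w \<longrightarrow> w = m))"

definition ray_arc :: "'a \<Rightarrow> 'b" where
  "ray_arc v = (if up v then THE e. e \<in> Q.E \<and> tail G e = v else THE e. e \<in> P.E \<and> head G e = v)"

definition ray_next :: "'a \<Rightarrow> 'a" where
  "ray_next v = (if up v then head G (ray_arc v) else tail G (ray_arc v))"

definition stop_on :: "'a \<Rightarrow> 'a" where
  "stop_on v = (THE m. stop m \<and> P.own m = P.own v)"

text \<open>
  The key increases lexicographically along the ray, which therefore never repeats a vertex.  The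
  step from \<open>down\<close> to \<open>up\<close> is the critical one: the walker at the new vertex could leave it only
  after some walker had come to a later vertex of that path of \<open>P\<close>, which must be the last stop.
\<close>

definition key :: "'a \<Rightarrow> nat \<times> nat" where
  "key v = (if up v then (time (head G (ray_arc v)), 0)
            else (time (stop_on v), Suc (length (snd (P.own v)) - P.pos v)))"

section \<open>Single steps of the ray\<close>

lemma stop_on_eq: "stop m \<Longrightarrow> P.own m = P.own v \<Longrightarrow> stop_on v = m"
  unfolding stop_on_def using stop_unique by (intro the_equality) auto

lemma down_not_up: "down v \<Longrightarrow> \<not> up v"
  by (auto simp: down_def up_def)

lemma stop_not_up: "stop v \<Longrightarrow> \<not> up v"
  by (auto simp: up_def)

text \<open>The stop itself is the witness \<open>m\<close>: no other reached vertex lies at or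
  beyond its position.\<close>

lemma stop_down:
  assumes "stop v" "v \<notin> Ini P"
  shows "down v"
proof -
  have "w = v" if "w \<in> reached" "w \<in> P.V" "P.own w = P.own v" "P.pos v \<le> P.pos w" for w
    using stop_last(1)[OF assms(1)] stop_last(2)[OF assms(1) that(1)] that
    by (intro P.own_pos_inj) (auto simp: later_def)
  then show ?thesis
    unfolding down_def using assms stop_last(1)[OF assms(1)] by blast
qed

lemma up_step:
  assumes "up v"
  shows "ray_arc v \<in> Q.E" "tail G (ray_arc v) = v" "ray_next v = head G (ray_arc v)"
    "ray_next v \<in> reached" "up (ray_next v) \<or> stop (ray_next v) \<and> down (ray_next v)"
    "ray_next v \<notin> Ini P"
proof -
  from assms obtain e where e: "e \<in> Q.E" "tail G e = v" "head G e \<in> reached"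
    by (auto simp: up_def stop_def)
  then have "ray_arc v = e"
    unfolding ray_arc_def using assms Q.E_tail_inj by (auto intro!: the_equality)
  with e show arc: "ray_arc v \<in> Q.E" "tail G (ray_arc v) = v" by auto
  show nxt: "ray_next v = head G (ray_arc v)" using assms by (simp add: ray_next_def)
  show *: "ray_next v \<in> reached" unfolding nxt using e \<open>ray_arc v = e\<close> by simp
  \<comment> \<open>Heads of arcs of \<open>Q\<close> avoid \<open>Ini Q\<close>, hence
    \<open>Ini P\<close>; so a stop entered this way can be left backwards along
    \<open>P\<close>.\<close>
  show "ray_next v \<notin> Ini P"
    unfolding nxt using Q.head_notin_Ini[OF arc(1)] Ini_subset by auto
  with * show "up (ray_next v) \<or> stop (ray_next v) \<and> down (ray_next v)"
    using stop_down by (auto simp: up_def)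
qed

lemma down_step:
  assumes "down v"
  shows "ray_arc v \<in> P.E" "head G (ray_arc v) = v" "ray_next v = tail G (ray_arc v)"
    "\<not> stop (ray_next v)" "up (ray_next v) \<or> down (ray_next v)"
    "P.own (ray_next v) = P.own v" "Suc (P.pos (ray_next v)) = P.pos v"
proof -
  from assms obtain e where e: "e \<in> P.E" "head G e = v"
    using P.in_arc by (auto simp: down_def)
  then have eq: "ray_arc v = e"
    unfolding ray_arc_def using down_not_up[OF assms] P.E_head_inj by (auto intro!: the_equality)
  with e show arc: "ray_arc v \<in> P.E" "head G (ray_arc v) = v" by auto
  show nxt: "ray_next v = tail G (ray_arc v)"
    using down_not_up[OF assms] by (simp add: ray_next_def)
  from nxt eq e show own: "P.own (ray_next v) = P.own v"
    and pos: "Suc (P.pos (ray_next v)) = P.pos v"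
    by (metis P.E_cases)+
  have V: "ray_next v \<in> P.V" using nxt eq e by (metis P.E_cases)
  from assms obtain m where m: "stop m" "P.own m = P.own v" "P.pos v \<le> P.pos m"
    "\<forall>w \<in> reached \<inter> P.V. P.own w = P.own v \<and> P.pos v \<le> P.pos w \<longrightarrow> w = m"
    by (auto simp: down_def)
  \<comment> \<open>The only stop on this path of \<open>P\<close> is \<open>m\<close>, and the new
    vertex lies strictly before it.\<close>
  show ns: "\<not> stop (ray_next v)"
    using stop_unique[OF _ m(1)] own pos m(2,3) by auto
  show "up (ray_next v) \<or> down (ray_next v)"
  proof (cases "ray_next v \<in> reached")
    case True
    with ns show ?thesis by (simp add: up_def)
  next
    case False
    have "w = m" if w: "w \<in> reached \<inter> P.V" "P.own w = P.own v" "P.pos (ray_next v) \<le> P.pos w" for w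
    proof -
      have "P.pos w \<noteq> P.pos (ray_next v)"
        using False V w own P.own_pos_inj[of w "ray_next v"] by auto
      with w pos m(4) show ?thesis by auto
    qed
    \<comment> \<open>Since \<open>Ini P\<close> lies in \<open>Ini Q\<close>, it is reached: the
      backward walk meets a reached vertex at the latest at the start of the path of
      \<open>P\<close>.\<close>
    moreover have "ray_next v \<notin> Ini P" using False Ini_subset Ini_reached by auto
    ultimately show ?thesis
      unfolding down_def using V m pos own
      by (intro disjI2 conjI exI[of _ m]) auto
  qed
qed

lemma key_step:
  assumes "up v \<or> down v"
  shows "(key v, key (ray_next v)) \<in> less_than <*lex*> less_than"
proof (cases "up v")
  case True
  note s = up_step[OF True]
  show ?thesis
  proof (cases "up (ray_next v)")
    case True
    note s' = up_step[OF True]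
    have "time (ray_next v) < time (head G (ray_arc (ray_next v)))"
      using reached_head(2)[OF s'(1)] s'(2,3,4) by simp
    with True \<open>up v\<close> s(3) show ?thesis by (simp add: key_def)
  next
    case False
    \<comment> \<open>The first components agree here; the \<open>Suc\<close> in the second one
      makes the increase strict.\<close>
    with s(5) have "stop (ray_next v)" by simp
    then have "stop_on (ray_next v) = ray_next v" by (intro stop_on_eq) auto
    with False \<open>up v\<close> s(3) show ?thesis by (simp add: key_def)
  qed
next
  case False
  with assms have d: "down v" by simp
  note s = down_step[OF d]
  have same: "stop_on (ray_next v) = stop_on v" by (simp add: stop_on_def s(6))
  show ?thesis
  proof (cases "up (ray_next v)")
    case True
    note s' = up_step[OF True]
    from d obtain m where m: "stop m" "P.own m = P.own v"
      "\<forall>w \<in> reached \<inter> P.V. P.own w = P.own v \<and> P.pos v \<le> P.pos w \<longrightarrow> w = m"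
      by (auto simp: down_def)
    have "ray_next v \<in> P.V" using s(1,3) by (metis P.E_cases)
    then obtain w where w: "w \<in> reached" "later (ray_next v) w"
      "time w < time (head G (ray_arc (ray_next v)))"
      using reached_head(3)[OF s'(1)] s'(2,3,4) by auto
    \<comment> \<open>Later than \<open>ray_next v\<close> means at or beyond \<open>v\<close>,
      where \<open>m\<close> is the only reached vertex. Hence the first component grows.\<close>
    then have "w = m" using m(3) s(6,7) by (auto simp: later_def)
    moreover have "stop_on v = m" using stop_on_eq m by simp
    ultimately show ?thesis using w(3) True False by (simp add: key_def)
  next
    case nu: False
    \<comment> \<open>The stop is unchanged and the position drops; this bound keeps the natural
      subtraction in \<open>key\<close> from truncating.\<close>
    have "P.pos v \<le> length (snd (P.own v))" using d by (metis P.V_cases down_def)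
    with nu False same s(6,7) show ?thesis by (auto simp: key_def)
  qed
qed

text \<open>Each step uses up an arc of one finite path of \<open>Q\<close>. This also supplies the
  first vertex of the ray.\<close>

lemma up_eventually_stop:
  "up v \<Longrightarrow> \<exists>k. stop ((ray_next ^^ k) v) \<and> (ray_next ^^ k) v \<notin> Ini P"
proof (induction "length (snd (Q.own v)) - Q.pos v" arbitrary: v rule: less_induct)
  case less
  note s = up_step[OF less.prems]
  have "length (snd (Q.own (ray_next v))) - Q.pos (ray_next v) < length (snd (Q.own v)) - Q.pos v"
    using Q.E_cases[OF s(1)] s(2,3) by (metis diff_less_mono2 lessI)
  show ?case
  proof (cases "up (ray_next v)")
    case True
    then obtain k where "stop ((ray_next ^^ k) (ray_next v)) \<and> (ray_next ^^ k) (ray_next v) \<notin> Ini P"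
      using less.hyps \<open>_ < _\<close> by blast
    then show ?thesis by (intro exI[of _ "Suc k"]) (simp add: funpow_swap1)
  next
    case False
    with s(5,6) show ?thesis by (intro exI[of _ 1]) simp
  qed
qed

text \<open>Each backward step lowers the position on one path of \<open>P\<close>.\<close>

lemma down_eventually_up: "down v \<Longrightarrow> \<exists>k. up ((ray_next ^^ k) v)"
proof (induction "P.pos v" arbitrary: v rule: less_induct)
  case less
  note s = down_step[OF less.prems]
  show ?case
  proof (cases "up (ray_next v)")
    case True
    then show ?thesis by (intro exI[of _ 1]) simp
  next
    case False
    with s(5,7) obtain k where "up ((ray_next ^^ k) (ray_next v))"
      using less.hyps[of "ray_next v"] by auto
    then show ?thesis by (intro exI[of _ "Suc k"]) (simp add: funpow_swap1)
  qed
qed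

end

section \<open>The alternating comb\<close>

locale comb_construction = excess_linkage +
  fixes t :: 'a
  assumes stop_t: "stop t" and t_notin: "t \<notin> Ini P" and exits: "dimaze G B0"
begin

definition ray :: "nat \<Rightarrow> 'a" where
  "ray n = (ray_next ^^ n) t"

definition ray_graph :: "('a, 'b) pre_digraph" where
  "ray_graph = \<lparr>verts = range ray, arcs = range (\<lambda>n. ray_arc (ray n)), tail = tail G, head = head G\<rparr>"

definition stops :: "'a set" where
  "stops = ray ` {n. stop (ray n)}"

definition teeth :: "('a \<times> 'b awalk) set" where
  "teeth = P.suffix_path ` stops"

definition comb :: "('a, 'b) pre_digraph" where
  "comb = \<lparr>verts = range ray \<union> (\<Union>S\<in>teeth. path_verts G S),
           arcs = range (\<lambda>n. ray_arc (ray n)) \<union> (\<Union>S\<in>teeth. set (snd S)),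
           tail = tail G, head = head G\<rparr>"

lemma ray_0: "ray 0 = t"
  by (simp add: ray_def)

lemma ray_Suc: "ray (Suc n) = ray_next (ray n)"
  by (simp add: ray_def)

lemma ray_add: "ray (k + n) = (ray_next ^^ k) (ray n)"
  by (simp add: ray_def funpow_add)

lemma ray_up_down: "up (ray n) \<or> down (ray n)"
  by (induction n) (use stop_down[OF stop_t t_notin] up_step(5) down_step(5) ray_0 ray_Suc in auto)

lemma key_ray_less:
  assumes "i < j"
  shows "(key (ray i), key (ray j)) \<in> less_than <*lex*> less_than"
proof -
  have "trans (less_than <*lex*> less_than)" by simp
  with assms show ?thesis
    by (induction j) (metis not_less0, metis key_step ray_Suc ray_up_down less_Suc_eq transD)
qed

text \<open>Keys strictly increase along the ray, and a well-founded order is irreflexive.\<close>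

lemma inj_ray: "inj ray"
proof -
  have "wf (less_than <*lex*> less_than)" by (intro wf_lex_prod wf_less_than)
  then have "ray i \<noteq> ray j" if "i < j" for i j
    using key_ray_less[OF that] by (metis wf_not_refl)
  then show ?thesis by (intro linorder_injI)
qed

lemma ray_arc_ends:
  "up (ray n) \<Longrightarrow> tail G (ray_arc (ray n)) = ray n \<and> head G (ray_arc (ray n)) = ray (Suc n)"
  "down (ray n) \<Longrightarrow> head G (ray_arc (ray n)) = ray n \<and> tail G (ray_arc (ray n)) = ray (Suc n)"
  using up_step(2,3) down_step(2,3) by (auto simp: ray_Suc)

lemma ray_arc_end_set: "{tail G (ray_arc (ray n)), head G (ray_arc (ray n))} = {ray n, ray (Suc n)}"
  using ray_up_down[of n] ray_arc_ends[of n] by auto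

lemma ray_arc_in_arcs: "ray_arc (ray n) \<in> arcs G"
  using ray_up_down[of n] up_step(1) down_step(1) by (metis P.E_cases Q.E_cases)

lemma ray_in_verts: "ray n \<in> verts G"
  using ray_arc_end_set[of n] ray_arc_in_arcs[of n] P.wellformed by (metis insertCI insertE singletonD)

lemma inj_ray_arc: "inj (\<lambda>n. ray_arc (ray n))"
proof (rule injI)
  fix i j assume "ray_arc (ray i) = ray_arc (ray j)"
  then have "{ray i, ray (Suc i)} = {ray j, ray (Suc j)}" using ray_arc_end_set by metis
  then show "i = j" using inj_ray by (auto simp: doubleton_eq_iff inj_eq)
qed

section \<open>The ray is alternating\<close>

lemma underlying_ray_graph: "underlying_ray ray_graph ray"
  unfolding underlying_ray_def
proof (intro conjI exI[of _ "\<lambda>n. ray_arc (ray n)"])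
  show "wf_digraph ray_graph"
    using ray_arc_end_set by (unfold_locales) (auto simp: ray_graph_def)
  show "inj ray" by (rule inj_ray)
  show "bij_betw (\<lambda>n. ray_arc (ray n)) UNIV (arcs ray_graph)"
    using inj_ray_arc by (simp add: bij_betw_def ray_graph_def)
qed (use ray_arc_end_set in \<open>auto simp: ray_graph_def\<close>)

lemma stop_Suc_iff: "stop (ray (Suc n)) \<longleftrightarrow> up (ray n) \<and> down (ray (Suc n))"
  using ray_up_down up_step(5) down_step(4) stop_not_up down_not_up by (metis ray_Suc)

text \<open>An arc enters \<open>ray n\<close> either by a forward step from its predecessor or by a
  backward step taken at \<open>ray n\<close>. Both occur exactly where the ray turns at a stop;
  \<open>ray 0\<close> has no predecessor.\<close>

lemma in_degree_ray: "in_degree ray_graph (ray n) = 2 \<longleftrightarrow> n > 0 \<and> stop (ray n)"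
proof -
  let ?K = "{k. up (ray k) \<and> n = Suc k \<or> down (ray k) \<and> n = k}"
  have "head G (ray_arc (ray k)) = ray n \<longleftrightarrow> k \<in> ?K" for k
    using ray_up_down[of k] ray_arc_ends[of k] down_not_up[of "ray k"] inj_ray
    by (auto simp: inj_eq)
  then have "in_arcs ray_graph (ray n) = (\<lambda>n. ray_arc (ray n)) ` ?K"
    by (auto simp: in_arcs_def ray_graph_def)
  then have card: "in_degree ray_graph (ray n) = card ?K"
    unfolding in_degree_def using inj_ray_arc by (simp add: card_image inj_on_def)
  show ?thesis
  proof (cases n)
    case 0
    then have "?K \<subseteq> {0}" by auto
    then have "card ?K \<le> 1" using card_mono[of "{0::nat}" ?K] by simp
    with card 0 show ?thesis by simp
  next
    case (Suc j)
    then have "?K = (if up (ray j) then {j} else {}) \<union> (if down (ray n) then {n} else {})"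
      by auto
    with Suc have "card ?K = 2 \<longleftrightarrow> up (ray j) \<and> down (ray n)" by (auto simp: card_insert_if)
    with card Suc stop_Suc_iff show ?thesis by simp
  qed
qed

lemma stops_eq: "insert (ray 0) {v \<in> verts ray_graph. in_degree ray_graph v = 2} = stops"
proof -
  have "{v \<in> verts ray_graph. in_degree ray_graph v = 2} = ray ` {n. n > 0 \<and> stop (ray n)}"
  proof -
    have "verts ray_graph = range ray" by (simp add: ray_graph_def)
    then show ?thesis by (auto simp: in_degree_ray)
  qed
  moreover have "{n. stop (ray n)} = insert 0 {n. n > 0 \<and> stop (ray n)}"
    using stop_t by (auto simp: ray_0)
  ultimately show ?thesis by (simp add: stops_def)
qed

lemma stop_after: "\<exists>m\<ge>n. stop (ray m)"
proof -
  have *: "\<exists>m\<ge>n. stop (ray m)" if "up (ray n)" for n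
    using up_eventually_stop[OF that] ray_add[of _ n] by (metis le_add2)
  show ?thesis
  proof (cases "up (ray n)")
    case False
    then obtain k where "up (ray (k + n))"
      using ray_up_down[of n] down_eventually_up[of "ray n"] by (auto simp: ray_add)
    from *[OF this] show ?thesis by (meson le_add2 order_trans)
  qed (rule *)
qed

lemma alternating_ray_graph: "alternating_ray ray_graph ray"
proof -
  have "infinite {n. stop (ray n)}"
    unfolding infinite_nat_iff_unbounded_le using stop_after by auto
  then have "infinite (ray ` {n. stop (ray n)})"
    using inj_ray by (simp add: finite_image_iff inj_on_def)
  then have "infinite stops" by (simp add: stops_def)
  then have "infinite {v \<in> verts ray_graph. in_degree ray_graph v = 2}"
    unfolding stops_eq[symmetric] by simp
  then show ?thesis by (simp add: alternating_ray_def underlying_ray_graph)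
qed

text \<open>These notions depend only on \<open>tail\<close> and \<open>head\<close>, which
  \<open>comb\<close> shares with \<open>G\<close>.\<close>

lemma comb_compatible:
  "pre_digraph.awalk_verts comb = P.awalk_verts" "pre_digraph.cas comb = P.cas"
  by (intro compatible_awalk_verts compatible_cas; simp add: compatible_def comb_def)+

section \<open>The teeth and the comb\<close>

lemma stops_V: "v \<in> stops \<Longrightarrow> v \<in> P.V"
  using stop_last(1) by (auto simp: stops_def)

lemma teeth_arc:
  assumes "v \<in> stops" "e \<in> set (snd (P.suffix_path v))"
  shows "e \<in> arcs G" "tail G e \<in> path_verts G (P.suffix_path v)"
    "head G e \<in> path_verts G (P.suffix_path v)"
proof -
  have "P.awalk v (snd (P.suffix_path v)) (path_end G (P.suffix_path v))"
    using P.suffix_path(1)[OF stops_V[OF assms(1)]] by (simp add: P.apath_def)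
  moreover have "fst (P.suffix_path v) = v" by (simp add: P.suffix_path_def)
  ultimately show "e \<in> arcs G" "tail G e \<in> path_verts G (P.suffix_path v)"
    "head G e \<in> path_verts G (P.suffix_path v)"
    using assms(2) P.awalk_verts_arc1 P.awalk_verts_arc2 by (auto simp: P.awalk_def)
qed

lemma wf_comb: "wf_digraph comb"
proof
  fix e assume "e \<in> arcs comb"
  then have "{tail G e, head G e} \<subseteq> verts comb"
    using ray_arc_end_set teeth_arc(2,3) by (fastforce simp: comb_def teeth_def)
  then show "tail comb e \<in> verts comb" "head comb e \<in> verts comb" by (auto simp: comb_def)
qed

lemma comb_subgraph: "subgraph comb G"
proof -
  have "path_verts G (P.suffix_path v) \<subseteq> verts G" if "v \<in> stops" for v
  proof -
    have "P.awalk v (snd (P.suffix_path v)) (path_end G (P.suffix_path v))"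
      using P.suffix_path(1)[OF stops_V[OF that]] by (simp add: P.apath_def)
    moreover have "fst (P.suffix_path v) = v" by (simp add: P.suffix_path_def)
    ultimately show ?thesis by auto
  qed
  then have "verts comb \<subseteq> verts G"
    using ray_in_verts by (auto simp: comb_def teeth_def)
  moreover have "arcs comb \<subseteq> arcs G"
    using ray_arc_in_arcs teeth_arc(1) by (auto simp: comb_def teeth_def)
  ultimately show ?thesis
    using wf_comb P.wf_digraph by (simp add: subgraph_def compatible_def comb_def)
qed

lemma ray_subgraph: "subgraph ray_graph comb"
  using underlying_ray_graph wf_comb
  by (auto simp: subgraph_def compatible_def underlying_ray_def ray_graph_def comb_def)

lemma teeth_ends: "path_end G ` teeth \<subseteq> B0"
  using P.suffix_path(3) stops_V Ter_P by (auto simp: teeth_def)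

lemma teeth_linkage: "linkage comb (path_end G ` teeth) teeth"
proof -
  have "pre_digraph.apath comb v (snd (P.suffix_path v)) (path_end G (P.suffix_path v))"
    if "v \<in> stops" for v
    using P.suffix_path(1)[OF stops_V[OF that]] that
    unfolding pre_digraph.apath_def pre_digraph.awalk_def comb_compatible
    by (auto simp: comb_def teeth_def stops_def)
  moreover have "path_verts G (P.suffix_path v) \<inter> path_verts G (P.suffix_path w) = {}"
    if "v \<in> stops" "w \<in> stops" "P.suffix_path v \<noteq> P.suffix_path w" for v w
  proof -
    have "stop v" "stop w" "v \<noteq> w" using that by (auto simp: stops_def)
    \<comment> \<open>Distinct stops lie on distinct paths of \<open>P\<close>, so their final
      segments are disjoint.\<close>
    then have "P.own v \<noteq> P.own w" using stop_unique by blast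
    then show ?thesis using P.suffix_path(2) stops_V that(1,2) by auto
  qed
  ultimately show ?thesis
    unfolding linkage_def comb_compatible teeth_def by (auto simp: P.suffix_path_def)
qed

lemma teeth_meet_ray:
  assumes "S \<in> teeth"
  shows "path_verts G S \<inter> range ray = {fst S}"
proof -
  from assms obtain v where v: "v \<in> stops" "S = P.suffix_path v" by (auto simp: teeth_def)
  then have st: "stop v" by (auto simp: stops_def)
  have verts: "path_verts G S = {w \<in> P.V. P.own w = P.own v \<and> P.pos v \<le> P.pos w}"
    using P.suffix_path(2)[OF stops_V[OF v(1)]] v(2) by simp
  have "w = v" if w: "w \<in> path_verts G S" "w = ray n" for w n
  proof -
    have *: "w \<in> P.V" "P.own w = P.own v" "P.pos v \<le> P.pos w" using w verts by auto
    \<comment> \<open>A reached vertex is not later than the stop \<open>v\<close>; a vertex on a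
      backward stretch is not beyond the stop of its path, which is again \<open>v\<close>.\<close>
    have "P.pos w \<le> P.pos v"
    proof (cases "up w")
      case True
      then show ?thesis
        using stop_last(1)[OF st] stop_last(2)[OF st, of w] * by (auto simp: up_def later_def)
    next
      case False
      then obtain m where "stop m" "P.own m = P.own w" "P.pos w \<le> P.pos m"
        using ray_up_down[of n] w(2) by (auto simp: down_def)
      moreover from this have "m = v" using stop_unique[OF _ st] * by simp
      ultimately show ?thesis by simp
    qed
    with * st stop_last(1) show ?thesis by (intro P.own_pos_inj) auto
  qed
  moreover have "v \<in> path_verts G S" "v \<in> range ray" "fst S = v"
    using verts stops_V v by (auto simp: stops_def P.suffix_path_def)
  ultimately show ?thesis by auto
qed

lemma alternating_comb: "alternating_comb comb (path_end G ` teeth)"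
  unfolding alternating_comb_def
proof (intro conjI exI[of _ ray_graph] exI[of _ ray] exI[of _ teeth])
  have "b \<in> verts comb \<and> out_arcs comb b = {}" if "b \<in> path_end G ` teeth" for b
  proof
    from that obtain S where "S \<in> teeth" "b = path_end G S" by auto
    then have "b \<in> (\<Union>S\<in>teeth. path_verts G S)" by (metis UN_I P.awalk_verts_non_Nil last_in_set)
    then show "b \<in> verts comb" by (simp add: comb_def)
    have "out_arcs G b = {}" using that teeth_ends exits by (auto simp: dimaze_def)
    moreover have "out_arcs comb b \<subseteq> out_arcs G b"
      using comb_subgraph by (auto simp: subgraph_def compatible_def)
    ultimately show "out_arcs comb b = {}" by auto
  qed
  then show "dimaze comb (path_end G ` teeth)"
    using wf_comb by (auto simp: dimaze_def)
  show "alternating_ray ray_graph ray" by (rule alternating_ray_graph)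
  show "subgraph ray_graph comb" by (rule ray_subgraph)
  show "linkage comb (path_end G ` teeth) teeth" by (rule teeth_linkage)
  show "Ini teeth = insert (ray 0) {v \<in> verts ray_graph. in_degree ray_graph v = 2}"
    unfolding stops_eq by (auto simp: Ini_def teeth_def P.suffix_path_def image_image)
  show "Ter comb teeth = path_end G ` teeth"
    by (simp add: Ter_def comb_compatible)
  show "\<forall>S\<in>teeth. path_verts comb S \<inter> verts ray_graph = {fst S}"
    using teeth_meet_ray by (simp add: comb_compatible ray_graph_def)
  show "verts comb = verts ray_graph \<union> (\<Union>S\<in>teeth. path_verts comb S)"
    unfolding comb_compatible by (simp add: comb_def ray_graph_def)
  show "arcs comb = arcs ray_graph \<union> (\<Union>S\<in>teeth. set (snd S))"
    by (simp add: comb_def ray_graph_def)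
qed

end

section \<open>Maximal linkable sets\<close>

lemma (in excess_linkage) excess_imp_alternating_comb:
  assumes "dimaze G B0" "x \<in> Ini Q" "x \<notin> Ini P"
  shows "contains_alternating_comb G B0"
proof -
  have "x \<in> reached" using assms(2) Ini_reached by auto
  \<comment> \<open>Either \<open>x\<close> is itself a stop, or the forward walk from
    \<open>x\<close> leads to one outside \<open>Ini P\<close>.\<close>
  then obtain t where "stop t" "t \<notin> Ini P"
    using up_eventually_stop[of x] assms(3) by (auto simp: up_def)
  then interpret comb_construction G B0 P Q t
    using assms(1) by unfold_locales
  show ?thesis
    unfolding contains_alternating_comb_def
    using alternating_comb comb_subgraph teeth_ends by blast
qed

text \<open>Exits have no outgoing arcs, so an exit on a path is its end; the missed exits therefore
  lie on no path.\<close>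

lemma linkage_add_trivial:
  assumes "dimaze D B0" "linkage D B0 P"
  defines "N \<equiv> B0 - Ter D P"
  shows "linkage D B0 (P \<union> (\<lambda>b. (b, [])) ` N)" "Ini P \<inter> N = {}"
proof -
  interpret wf_digraph D using assms(1) by (simp add: dimaze_def)
  interpret path_system D B0 P using assms(2) by unfold_locales
  have "N \<inter> V = {}"
  proof (rule ccontr)
    assume "N \<inter> V \<noteq> {}"
    then obtain b where b: "b \<in> V" "b \<notin> Ter D P" "b \<in> B0" by (auto simp: N_def)
    then obtain e where "e \<in> E" "tail D e = b" using out_arc by blast
    then have "e \<in> out_arcs D b" by (metis E_cases in_out_arcs_conv)
    moreover have "out_arcs D b = {}" using b(3) assms(1) unfolding dimaze_def by blast
    ultimately show False by simp
  qed
  then have disj: "S \<in> P \<Longrightarrow> b \<in> N \<Longrightarrow> b \<notin> path_verts D S" for S b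
    by (auto simp: V_def)
  show "Ini P \<inter> N = {}" using \<open>N \<inter> V = {}\<close> Ini_V by auto
  have "N \<subseteq> verts D" "N \<subseteq> B0" using assms(1) by (auto simp: dimaze_def N_def)
  then show "linkage D B0 (P \<union> (\<lambda>b. (b, [])) ` N)"
    using assms(2) disj unfolding linkage_def by (simp add: ball_Un apath_Nil_iff) blast
qed

theorem lemma2p3:
  fixes D :: "('a, 'b) pre_digraph" and B0 B :: "'a set"
  assumes "dimaze D B0"
    and "\<not> contains_alternating_comb D B0"
    and "B \<subseteq> verts D"
  shows "(linkable D B0 B \<and> (\<forall>I\<subseteq>verts D. linkable D B0 I \<and> B \<subseteq> I \<longrightarrow> I = B))
         \<longleftrightarrow> linkable_onto_exits D B0 B"
proof (intro iffI conjI allI impI)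
  interpret wf_digraph D using assms(1) by (simp add: dimaze_def)
  assume max: "linkable D B0 B \<and> (\<forall>I\<subseteq>verts D. linkable D B0 I \<and> B \<subseteq> I \<longrightarrow> I = B)"
  then obtain P where P: "linkage D B0 P" "Ini P = B" by (auto simp: linkable_def)
  interpret path_system D B0 P using P(1) by unfold_locales
  define N where "N = B0 - Ter D P"
  have "linkable D B0 (B \<union> N)"
    unfolding linkable_def
    using linkage_add_trivial(1)[OF assms(1) P(1)] P(2)
    by (intro exI[of _ "P \<union> (\<lambda>b. (b, [])) ` N"]) (auto simp: N_def Ini_def image_image image_Un)
  moreover have "N \<subseteq> verts D" using assms(1) by (auto simp: dimaze_def N_def)
  \<comment> \<open>Maximality absorbs the missed exits into \<open>B\<close>; as they are disjoint
    from \<open>B\<close>, there are none.\<close>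
  ultimately have "B \<union> N = B" using max assms(3) by (metis Un_least Un_upper1)
  moreover have "B \<inter> N = {}"
    unfolding N_def using linkage_add_trivial(2)[OF assms(1) P(1)] P(2) by simp
  ultimately have "Ter D P = B0" using Ter_subset by (auto simp: N_def)
  with P show "linkable_onto_exits D B0 B" by (auto simp: linkable_onto_exits_def)
next
  assume "linkable_onto_exits D B0 B"
  then obtain P where P: "linkage D B0 P" "Ini P = B" "Ter D P = B0"
    by (auto simp: linkable_onto_exits_def)
  then show "linkable D B0 B" by (auto simp: linkable_def)
  fix I assume "I \<subseteq> verts D" and I: "linkable D B0 I \<and> B \<subseteq> I"
  then obtain Q where Q: "linkage D B0 Q" "Ini Q = I" by (auto simp: linkable_def)
  interpret wf_digraph D using assms(1) by (simp add: dimaze_def)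
  interpret excess_linkage D B0 P Q
    using P Q I by unfold_locales auto
  \<comment> \<open>A vertex of \<open>I\<close> outside \<open>B\<close> would be initial for
    \<open>Q\<close> but not for \<open>P\<close>, and so force an alternating comb.\<close>
  show "I = B"
    using excess_imp_alternating_comb[OF assms(1)] assms(2) P(2) Q(2) I by auto
qed

end
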